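(* Let $t>2$ be a real number and let $u>1/u$ be the roots of $x^2-tx+1=0$. Let $(q_n)_{n\in\mathbb{Z}}$ be defined by $q_0=1$, $q_1=t$, $q_n=tq_{n-1}-q_{n-2}$ for all $n\in\mathbb{Z}$. Then $t=u+1/u$ and $$\sum_{n=1}^{\infty}\mathcal{L}\left(\frac{1}{q_n^{\,2}}\right)=\mathcal{L}(1/u^2),\qquad \sum_{n=1}^{\infty}\mathcal{L}\left(\frac{t-2}{(q_n-q_{n-1})(q_{n-2}-q_{n-3})}\right)=\mathcal{L}(1-1/u^2).$$
   Context: The Rogers dilogarithm is the function on $[0,1]$ given by $\mathcal{L}(z)=\mathrm{Li}_2(z)+\frac12\log|z|\log(1-z)$, where $\mathrm{Li}_2(z)=\sum_{n\ge1}z^n/n^2$, with $\mathcal{L}(0)=0$ and $\mathcal{L}(1)=\pi^2/6$. The recurrence defining $q_n$ is extended to negative indices, so for example $q_{-1}=0$ and $q_{-2}=-1$. *)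

theory Defs
  imports Complex_Main
begin

(* The real dilogarithm series sum_{n >= 1} z^n / n^2, shifted to start at index 0;
   meaningful for |z| <= 1. *)
definition Li2 :: "real \<Rightarrow> real" where
  "Li2 z = (\<Sum>n. z ^ Suc n / (real (Suc n))\<^sup>2)"

(* The Rogers dilogarithm is a function on [0,1]; values outside [0,1] are irrelevant. *)
definition rogers_dilog :: "real \<Rightarrow> real" where
  "rogers_dilog z =
     (if z = 0 then 0
      else if z = 1 then pi\<^sup>2 / 6
      else Li2 z + 1 / 2 * ln \<bar>z\<bar> * ln (1 - z))"

end

theory Submission
  imports Defs "HOL-Analysis.Analysis" "HOL-Real_Asymp.Real_Asymp"
begin

text \<open>
  Write \<open>L\<close> for the Rogers dilogarithm. Together with \<open>L x + L (1 - x) = \<pi>\<^sup>2 / 6\<close>, Abel's five-term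
  relation says that, for \<open>0 < a < b < 1\<close>,
  \<open>L (1 - a / b) = L b - L a + L ((1 - b) / (1 - a)) - L (a (1 - b) / (b (1 - a)))\<close>.
  Put \<open>p = 1 / u\<^sup>2\<close>. For \<open>a = (1 - x) / (1 - p x)\<close> and for \<open>a = (1 + p x) / (1 + x)\<close>, with \<open>b\<close> the value
  of the same expression at \<open>p x\<close>, the last two arguments become \<open>p b, p a\<close> and \<open>p / a, p / b\<close>
  respectively, so that the right-hand side is a difference of one function at \<open>p x\<close> and \<open>x\<close>.
  By the closed form of \<open>q\<close>, the values \<open>1 - a / b\<close> along \<open>x = p\<^sup>n\<close> and \<open>x = u p\<^sup>n\<^sup>-\<^sup>1\<close> are the arguments
  of the two series, which therefore telescope.
\<close>

section \<open>Continuity and derivative of the Rogers dilogarithm\<close>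

lemma continuous_on_Li2: "continuous_on {0..1} Li2"
proof -
  have "uniform_limit {0..1} (\<lambda>n z. \<Sum>i<n. z ^ Suc i / (real (Suc i))\<^sup>2) Li2 sequentially"
    unfolding Li2_def
  proof (rule Weierstrass_m_test)
    fix n and z :: real assume "z \<in> {0..1}"
    then show "norm (z ^ Suc n / (real (Suc n))\<^sup>2) \<le> 1 / (real (Suc n))\<^sup>2"
      by (auto simp: power_le_one divide_right_mono simp del: power_Suc of_nat_Suc)
  next
    show "summable (\<lambda>n. 1 / (real (Suc n))\<^sup>2)"
      using sums_summable[OF inverse_squares_sums] by simp
  qed
  then show ?thesis
    by (rule uniform_limit_theorem[rotated]) (auto intro!: always_eventually continuous_intros)
qed

lemma Li2_0: "Li2 0 = 0"
  by (simp add: Li2_def)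

lemma Li2_1: "Li2 1 = pi\<^sup>2 / 6"
  using sums_unique[OF inverse_squares_sums] by (simp add: Li2_def add.commute)

text \<open>Termwise differentiation inside the unit disc turns the dilogarithm series into the
  logarithm series divided by \<open>x\<close>.\<close>

lemma has_real_derivative_Li2:
  assumes "0 < x" "x < 1"
  shows "(Li2 has_real_derivative - ln (1 - x) / x) (at x)"
proof -
  \<comment> \<open>Division by zero gives \<open>c 0 = 0\<close>, so the power series from index 0
    still has sum \<open>Li2\<close>, whose own indexing is shifted by one.\<close>
  define c :: "nat \<Rightarrow> real" where "c n = 1 / (real n)\<^sup>2" for n
  have c_Suc: "diffs c n = 1 / real (Suc n)" for n
    by (simp add: c_def diffs_def power2_eq_square del: of_nat_Suc)
  have summable_c: "summable (\<lambda>n. c n * z ^ n)" if "norm z < 1" for z :: real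
  proof (rule summable_comparison_test')
    show "summable (\<lambda>n. norm z ^ n)"
      using that by simp
    fix n :: nat
    have "c n \<le> 1" "c n \<ge> 0"
      by (cases "n = 0"; simp add: c_def)+
    then show "norm (c n * z ^ n) \<le> norm z ^ n"
      by (simp add: abs_mult power_abs mult_left_le_one_le)
  qed
  have Li2_c: "(\<Sum>n. c n * z ^ n) = Li2 z" if "norm z < 1" for z :: real
    using suminf_split_head[OF summable_c[OF that]] by (simp add: c_def Li2_def)
  have "((\<lambda>z. \<Sum>n. c n * z ^ n) has_real_derivative (\<Sum>n. diffs c n * x ^ n)) (at x)"
    using assms summable_c by (intro termdiffs_strong'[where K = 1]) auto
  then have "(Li2 has_real_derivative (\<Sum>n. diffs c n * x ^ n)) (at x)"
    by (rule has_field_derivative_transform_within_open[of _ _ _ "{0<..<1}"])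
      (use assms Li2_c in auto)
  moreover have "(\<Sum>n. diffs c n * x ^ n) = - ln (1 - x) / x"
  proof -
    have summ: "summable (\<lambda>n. diffs c n * x ^ n)"
      using assms summable_c by (intro termdiff_converges[where K = 1]) auto
    have "ln (1 - x) = (\<Sum>n. (-1) ^ n * (1 / real (n + 1)) * (1 - x - 1) ^ Suc n)"
      using assms by (intro ln_series) auto
    also have "\<dots> = (\<Sum>n. - x * (diffs c n * x ^ n))"
    proof (rule arg_cong[where f = suminf], rule ext)
      fix n
      have "(-1 :: real) ^ n * (- x) ^ n = x ^ n"
        by (simp flip: power_mult_distrib)
      then show "(-1) ^ n * (1 / real (n + 1)) * (1 - x - 1) ^ Suc n = - x * (diffs c n * x ^ n)"
        by (simp add: c_Suc)
    qed
    also have "\<dots> = - x * (\<Sum>n. diffs c n * x ^ n)"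
      using summ by (rule suminf_mult)
    finally show ?thesis
      using assms by simp
  qed
  ultimately show ?thesis by simp
qed

text \<open>The boundary clauses of the definition are subsumed because \<^prop>\<open>ln 0 = (0::real)\<close>.\<close>

lemma rogers_dilog_eq: "rogers_dilog z = Li2 z + 1 / 2 * ln \<bar>z\<bar> * ln (1 - z)"
  by (auto simp: rogers_dilog_def Li2_0 Li2_1)

lemma rogers_dilog_0: "rogers_dilog 0 = 0"
  and rogers_dilog_1: "rogers_dilog 1 = pi\<^sup>2 / 6"
  by (simp_all add: rogers_dilog_def)

text \<open>At either endpoint one logarithm diverges while the other vanishes fast enough for the
  product to tend to 0, its value there by \<open>ln 0 = 0\<close>. Continuity up to the endpoints
  allows constants to be evaluated at 0 and the telescoping limits to be taken at 1.\<close>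

lemma continuous_on_rogers_dilog: "continuous_on {0..1} rogers_dilog"
proof -
  let ?g = "\<lambda>z::real. ln \<bar>z\<bar> * ln (1 - z)"
  have "continuous_on {0..1} ?g"
    unfolding continuous_on_eq_continuous_within
  proof
    fix z :: real assume "z \<in> {0..1}"
    then consider "z = 0" | "z = 1" | "0 < z" "z < 1" by fastforce
    then show "continuous (at z within {0..1}) ?g"
    proof cases
      case 1
      have "(?g \<longlongrightarrow> 0) (at_right 0)" by real_asymp
      then show ?thesis
        using 1 by (simp add: continuous_within at_within_Icc_at_right)
    next
      case 2
      have "(?g \<longlongrightarrow> 0) (at_left 1)" by real_asymp
      then show ?thesis
        using 2 by (simp add: continuous_within at_within_Icc_at_left)
    next
      case 3
      then show ?thesis by (auto intro!: continuous_intros)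
    qed
  qed
  then have "continuous_on {0..1} (\<lambda>z. Li2 z + 1 / 2 * ?g z)"
    using continuous_on_Li2 by (intro continuous_on_add continuous_on_mult_left)
  then show ?thesis
    by (simp add: rogers_dilog_eq[abs_def])
qed

lemma continuous_on_rogers_dilog_compose [continuous_intros]:
  assumes "continuous_on S f" "\<And>x. x \<in> S \<Longrightarrow> 0 \<le> f x \<and> f x \<le> 1"
  shows "continuous_on S (\<lambda>x. rogers_dilog (f x))"
  by (rule continuous_on_compose2[OF continuous_on_rogers_dilog assms(1)]) (use assms(2) in auto)

lemma tendsto_rogers_dilog:
  assumes "(f \<longlongrightarrow> l) F" "0 \<le> l" "l \<le> 1" "\<And>x. 0 \<le> f x \<and> f x \<le> 1"
  shows "((\<lambda>x. rogers_dilog (f x)) \<longlongrightarrow> rogers_dilog l) F"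
  by (rule continuous_on_tendsto_compose[OF continuous_on_rogers_dilog])
    (use assms in auto)

text \<open>The product rule cancels half of the derivative of \<open>Li2\<close>; what remains is
  invariant under \<open>x \<mapsto> 1 - x\<close>, and this symmetry gives the reflection
  formula.\<close>

definition rogers_deriv :: "real \<Rightarrow> real" where
  "rogers_deriv x = - (ln (1 - x) / x + ln x / (1 - x)) / 2"

lemma has_real_derivative_rogers_dilog:
  assumes "0 < x" "x < 1"
  shows "(rogers_dilog has_real_derivative rogers_deriv x) (at x)"
proof -
  have "((\<lambda>z. Li2 z + 1 / 2 * ln z * ln (1 - z)) has_real_derivative rogers_deriv x) (at x)"
    using assms
    by (auto intro!: derivative_eq_intros has_real_derivative_Li2
        simp: rogers_deriv_def field_simps)
  then show ?thesis
    by (rule has_field_derivative_transform_within_open[of _ _ _ "{0<..<1}"])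
      (use assms in \<open>auto simp: rogers_dilog_eq\<close>)
qed

lemma has_real_derivative_rogers_dilog_compose:
  assumes "(f has_real_derivative f') (at x)" "0 < f x" "f x < 1"
  shows "((\<lambda>x. rogers_dilog (f x)) has_real_derivative rogers_deriv (f x) * f') (at x)"
  using DERIV_chain2[OF has_real_derivative_rogers_dilog assms(1)] assms by simp


section \<open>Functional equations\<close>

lemma rogers_dilog_reflection:
  assumes "0 \<le> x" "x \<le> 1"
  shows "rogers_dilog x + rogers_dilog (1 - x) = pi\<^sup>2 / 6"
proof -
  let ?F = "\<lambda>x. rogers_dilog x + rogers_dilog (1 - x)"
  have "?F x = ?F 0"
  proof (rule DERIV_isconst2[of 0 1])
    show "continuous_on {0..1} ?F"
      by (intro continuous_intros) auto
    fix z :: real assume "0 < z" "z < 1"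
    then show "(?F has_real_derivative 0) (at z)"
      by (auto intro!: derivative_eq_intros has_real_derivative_rogers_dilog_compose
          simp: rogers_deriv_def)
  qed (use assms in auto)
  then show ?thesis
    by (simp add: rogers_dilog_0 rogers_dilog_1)
qed

text \<open>For fixed \<open>y\<close>, the terms depending on \<open>x\<close> combine to a
  function with derivative zero, so they may be compared with their values at
  \<open>x = 0\<close>.\<close>

lemma rogers_dilog_five_term:
  assumes "0 \<le> x" "x < 1" "0 < y" "y < 1"
  shows "rogers_dilog x + rogers_dilog y =
    rogers_dilog (x * y) + rogers_dilog (x * (1 - y) / (1 - x * y))
      + rogers_dilog (y * (1 - x) / (1 - x * y))"
proof (cases "x = 0")
  case True
  then show ?thesis by (simp add: rogers_dilog_0)
next
  case False
  let ?Q = "\<lambda>x. x * (1 - y) / (1 - x * y)"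
  let ?R = "\<lambda>x. y * (1 - x) / (1 - x * y)"
  let ?F = "\<lambda>x. rogers_dilog x - rogers_dilog (x * y)
    - rogers_dilog (?Q x) - rogers_dilog (?R x)"
  have xy: "z * y < 1" if "0 \<le> z" "z < 1" for z
    using mult_strict_mono'[of z 1 y 1] that assms by auto
  have xy_le: "z * y \<le> z" "z * y \<le> y" if "0 \<le> z" "z < 1" for z
    using that assms by (auto simp: mult_left_le mult_left_le_one_le)
  \<comment> \<open>At 0 the product and \<open>?Q\<close> vanish and \<open>?R\<close> equals
    \<open>y\<close>, so \<open>?F 0\<close> is \<open>- rogers_dilog y\<close>.\<close>
  have "?F x = ?F 0"
  proof (rule DERIV_isconst2[of 0 x])
    show "continuous_on {0..x} ?F"
    proof (intro continuous_intros)
      fix z assume "z \<in> {0..x}"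
      then have z: "0 \<le> z" "z < 1" using assms by auto
      show "0 \<le> z \<and> z \<le> 1" using z by simp
      show "0 \<le> z * y \<and> z * y \<le> 1" using z xy[OF z] assms by simp
      show "0 \<le> ?Q z \<and> ?Q z \<le> 1" "0 \<le> ?R z \<and> ?R z \<le> 1"
        using z xy[OF z] xy_le[OF z] assms by (auto simp: divide_simps) (auto simp: algebra_simps)
    qed (use xy assms in fastforce)+
    fix z assume "0 < z" "z < x"
    then have z: "0 < z" "z < 1" using assms by auto
    define w where "w = 1 - z * y"
    have w: "w > 0" using xy z by (simp add: w_def)
    have Q1: "1 - ?Q z = (1 - z) / w" and R1: "1 - ?R z = (1 - y) / w"
      using w by (auto simp: w_def field_simps)
    have Qpos: "?Q z > 0" "?Q z < 1" "?R z > 0" "?R z < 1"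
      using Q1 R1 z assms w by (auto simp: w_def field_simps mult_strict_right_mono)
    have dQ: "(?Q has_real_derivative (1 - y) / w\<^sup>2) (at z)"
      using w by (auto intro!: derivative_eq_intros simp: w_def power2_eq_square field_simps)
    have dR: "(?R has_real_derivative - y * (1 - y) / w\<^sup>2) (at z)"
      using w by (auto intro!: derivative_eq_intros simp: w_def power2_eq_square field_simps)
    have dP: "((\<lambda>z. z * y) has_real_derivative y) (at z)"
      by (auto intro!: derivative_eq_intros)
    have "(?F has_real_derivative rogers_deriv z - rogers_deriv (z * y) * y
        - rogers_deriv (?Q z) * ((1 - y) / w\<^sup>2) - rogers_deriv (?R z) * (- y * (1 - y) / w\<^sup>2)) (at z)"
      using z Qpos dQ dR dP xy assms
      by (intro DERIV_diff has_real_derivative_rogers_dilog_compose has_real_derivative_rogers_dilog)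
        auto
    moreover have "rogers_deriv z - rogers_deriv (z * y) * y
        - rogers_deriv (?Q z) * ((1 - y) / w\<^sup>2) - rogers_deriv (?R z) * (- y * (1 - y) / w\<^sup>2) = 0"
    proof -
      \<comment> \<open>The logarithms of the four arguments and of their complements are integer
        combinations of these five. The derivative is therefore linear in them with rational
        coefficients, and its vanishing is pure algebra.\<close>
      define a b c d e where "a = ln z" "b = ln y" "c = ln (1 - z)" "d = ln (1 - y)" "e = ln w"
      have P: "rogers_deriv (z * y) * y = - (e / z + (a + b) * y / w) / 2"
        using z assms by (simp add: rogers_deriv_def a_b_c_d_e_def ln_mult w_def[symmetric])
          (simp add: field_simps)
      have lnQ: "ln (?Q z) = a + d - e" "ln (1 - ?Q z) = c - e"
        and lnR: "ln (?R z) = b + c - e" "ln (1 - ?R z) = d - e"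
        using z assms w unfolding Q1 R1
        by (simp_all add: a_b_c_d_e_def ln_mult ln_div flip: w_def)
      have Q: "rogers_deriv (?Q z) * ((1 - y) / w\<^sup>2) =
          - ((c - e) / (z * w) + (a + d - e) * (1 - y) / ((1 - z) * w)) / 2"
        unfolding rogers_deriv_def lnQ unfolding Q1 unfolding w_def[symmetric]
        using z assms w by (simp add: divide_simps power2_eq_square) algebra
      have R: "rogers_deriv (?R z) * (- y * (1 - y) / w\<^sup>2) =
          ((d - e) * (1 - y) / ((1 - z) * w) + (b + c - e) * y / w) / 2"
        unfolding rogers_deriv_def lnR unfolding R1 unfolding w_def[symmetric]
        using z assms w by (simp add: divide_simps power2_eq_square) algebra
      have "- (c / z + a / (1 - z)) / 2 + (e / z + (a + b) * y / w) / 2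
          + ((c - e) / (z * w) + (a + d - e) * (1 - y) / ((1 - z) * w)) / 2
          - ((d - e) * (1 - y) / ((1 - z) * w) + (b + c - e) * y / w) / 2 = 0"
        using z w unfolding w_def by (simp add: divide_simps) algebra
      then show ?thesis
        unfolding P Q R by (simp add: rogers_deriv_def a_b_c_d_e_def) argo
    qed
    ultimately show "(?F has_real_derivative 0) (at z)" by metis
  qed (use False assms in auto)
  then show ?thesis
    by (simp add: rogers_dilog_0)
qed

text \<open>This is the five-term relation at \<open>a / b\<close> and \<open>b\<close>, with
  reflection applied to \<open>a / b\<close> and to \<open>(b - a) / (1 - a)\<close>; the two
  constants cancel.\<close>

lemma rogers_dilog_quotient:
  assumes "0 < a" "a < b" "b < 1"
  shows "rogers_dilog (1 - a / b) = rogers_dilog b - rogers_dilog a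
    + rogers_dilog ((1 - b) / (1 - a)) - rogers_dilog (a * (1 - b) / (b * (1 - a)))"
proof -
  have "rogers_dilog (a / b) + rogers_dilog b = rogers_dilog a
      + rogers_dilog (a * (1 - b) / (b * (1 - a))) + rogers_dilog ((b - a) / (1 - a))"
  proof -
    have "a / b * b = a" "b * (1 - a / b) = b - a"
      using assms by (simp_all add: right_diff_distrib)
    then show ?thesis
      using rogers_dilog_five_term[of "a / b" b] assms by simp
  qed
  moreover have "rogers_dilog (a / b) + rogers_dilog (1 - a / b) = pi\<^sup>2 / 6"
    using assms by (intro rogers_dilog_reflection) auto
  moreover have "rogers_dilog ((1 - b) / (1 - a)) + rogers_dilog (1 - (1 - b) / (1 - a)) = pi\<^sup>2 / 6"
    using assms by (intro rogers_dilog_reflection) auto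
  moreover have "1 - (1 - b) / (1 - a) = (b - a) / (1 - a)"
    using assms by (simp add: field_simps)
  ultimately show ?thesis by simp
qed


section \<open>Two telescoping series\<close>

lemma rogers_dilog_diff_minus:
  assumes p: "0 < p" "p < 1" and x: "0 < x" "x < 1"
  defines "g \<equiv> \<lambda>x. rogers_dilog ((1 - x) / (1 - p * x)) + rogers_dilog (p * ((1 - x) / (1 - p * x)))"
  shows "rogers_dilog (x * (1 - p)\<^sup>2 / (1 - p * x)\<^sup>2) = g (p * x) - g x"
proof -
  define a b where "a = (1 - x) / (1 - p * x)" and "b = (1 - p * x) / (1 - p * (p * x))"
  have px: "p * x < x" "p * (p * x) < p * x" using p x by auto
  have pos: "1 - x > 0" "1 - p * x > 0" "1 - p * (p * x) > 0" using px x by linarith+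
  \<comment> \<open>The factored difference yields both the order \<open>a < b\<close> and the value
    of \<open>1 - a / b\<close>.\<close>
  have ba: "b - a = x * (1 - p)\<^sup>2 / ((1 - p * x) * (1 - p * (p * x)))"
    using pos unfolding a_def b_def by (simp add: divide_simps) algebra
  have a1: "1 - a = x * (1 - p) / (1 - p * x)" and b1: "1 - b = p * x * (1 - p) / (1 - p * (p * x))"
    using pos by (simp_all add: a_def b_def field_simps)
  have "0 < b - a" "0 < 1 - b" unfolding ba b1 using pos p x by auto
  then have ab: "0 < a" "a < b" "b < 1" using pos by (auto simp: a_def)
  have e1: "1 - a / b = x * (1 - p)\<^sup>2 / (1 - p * x)\<^sup>2"
  proof -
    have "1 - a / b = (b - a) / b" using ab by (simp add: diff_divide_distrib)
    then show ?thesis unfolding ba using pos by (simp add: b_def power2_eq_square)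
  qed
  have e2: "(1 - b) / (1 - a) = p * b"
    unfolding a1 b1 using pos p x by (simp add: b_def)
  have e3: "a * (1 - b) / (b * (1 - a)) = p * a"
  proof -
    have "a * (1 - b) / (b * (1 - a)) = a / b * ((1 - b) / (1 - a))" by simp
    then show ?thesis unfolding e2 using ab by simp
  qed
  show ?thesis
    using rogers_dilog_quotient[OF ab] unfolding e1 e2 e3 by (simp add: g_def a_def b_def)
qed

text \<open>No upper bound is put on \<open>x\<close>, because the second series starts at
  \<open>x = 1 / v\<close>, which exceeds 1.\<close>

lemma rogers_dilog_diff_plus:
  assumes p: "0 < p" "p < 1" and x: "0 < x"
  defines "g \<equiv> \<lambda>x. rogers_dilog ((1 + p * x) / (1 + x)) - rogers_dilog (p / ((1 + p * x) / (1 + x)))"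
  shows "rogers_dilog (x * (1 - p)\<^sup>2 / ((1 + x) * (1 + p * (p * x)))) = g (p * x) - g x"
proof -
  define a b where "a = (1 + p * x) / (1 + x)" and "b = (1 + p * (p * x)) / (1 + p * x)"
  have pos: "1 + x > 0" "1 + p * x > 0" "1 + p * (p * x) > 0"
    using p x by (auto intro!: add_pos_pos)
  have ba: "b - a = x * (1 - p)\<^sup>2 / ((1 + x) * (1 + p * x))"
    using pos unfolding a_def b_def by (simp add: divide_simps) algebra
  have a1: "1 - a = x * (1 - p) / (1 + x)" and b1: "1 - b = p * x * (1 - p) / (1 + p * x)"
    using pos by (simp_all add: a_def b_def field_simps)
  have "0 < b - a" "0 < 1 - b" unfolding ba b1 using pos p x by auto
  then have ab: "0 < a" "a < b" "b < 1" using pos by (auto simp: a_def)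
  have e1: "1 - a / b = x * (1 - p)\<^sup>2 / ((1 + x) * (1 + p * (p * x)))"
  proof -
    have "1 - a / b = (b - a) / b" using ab by (simp add: diff_divide_distrib)
    then show ?thesis unfolding ba using pos by (simp add: b_def)
  qed
  have e2: "(1 - b) / (1 - a) = p / a"
    unfolding a1 b1 using pos p x by (simp add: a_def)
  have e3: "a * (1 - b) / (b * (1 - a)) = p / b"
  proof -
    have "a * (1 - b) / (b * (1 - a)) = a / b * ((1 - b) / (1 - a))" by simp
    then show ?thesis unfolding e2 using ab by simp
  qed
  show ?thesis
    using rogers_dilog_quotient[OF ab] unfolding e1 e2 e3 by (simp add: g_def a_def b_def)
qed

text \<open>Since \<open>a\<close> tends to 1, the limit of \<open>g\<close> is
  \<open>rogers_dilog 1 + rogers_dilog p\<close>, and the starting value removes the first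
  summand.\<close>

lemma rogers_dilog_sums_minus:
  assumes p: "0 < p" "p < 1"
  shows "(\<lambda>k. rogers_dilog (p ^ Suc k * (1 - p)\<^sup>2 / (1 - p ^ Suc (Suc k))\<^sup>2)) sums rogers_dilog p"
proof -
  define a where "a x = (1 - x) / (1 - p * x)" for x
  define g where "g x = rogers_dilog (a x) + rogers_dilog (p * a x)" for x
  have lim: "(\<lambda>k. a (p ^ Suc k)) \<longlonglongrightarrow> (1 - 0) / (1 - p * 0)"
    unfolding a_def using p by (intro tendsto_intros LIMSEQ_power_zero[THEN LIMSEQ_Suc]) auto
  have a01: "0 \<le> a (p ^ Suc k) \<and> a (p ^ Suc k) \<le> 1" for k
  proof -
    have "p ^ Suc k < 1" using p power_Suc_less_one by blast
    moreover from this have "p * p ^ Suc k \<le> p ^ Suc k" using p by (intro mult_left_le_one_le) auto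
    ultimately show ?thesis unfolding a_def by auto
  qed
  then have "0 \<le> p * a (p ^ Suc k) \<and> p * a (p ^ Suc k) \<le> 1" for k
    using p by (auto intro: mult_le_one)
  with lim a01 have "(\<lambda>k. g (p ^ Suc k)) \<longlonglongrightarrow> rogers_dilog 1 + rogers_dilog (p * 1)"
    unfolding g_def using p by (intro tendsto_intros tendsto_rogers_dilog) auto
  then have "(\<lambda>k. g (p ^ Suc (Suc k)) - g (p ^ Suc k)) sums
      (rogers_dilog 1 + rogers_dilog (p * 1) - g (p ^ Suc 0))"
    by (rule telescope_sums)
  \<comment> \<open>At \<open>x = p\<close> the two arguments in \<open>g\<close> add up to 1, so
    reflection applies.\<close>
  moreover have "g (p ^ Suc 0) = rogers_dilog 1"
  proof -
    have "1 - p * p = (1 - p) * (1 + p)" by (simp add: algebra_simps)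
    then have "a p = 1 / (1 + p)" using p by (simp add: a_def)
    moreover from this have "p * a p = 1 - a p" using p by (simp add: field_simps)
    ultimately show ?thesis
      using p rogers_dilog_reflection[of "a p"] by (simp add: g_def rogers_dilog_1)
  qed
  moreover have "g (p ^ Suc (Suc k)) - g (p ^ Suc k) =
      rogers_dilog (p ^ Suc k * (1 - p)\<^sup>2 / (1 - p ^ Suc (Suc k))\<^sup>2)" for k
    using rogers_dilog_diff_minus[OF p, of "p ^ Suc k"] p power_Suc_less_one[of p k]
    by (simp add: g_def a_def)
  ultimately show ?thesis by simp
qed

text \<open>The limit of \<open>g\<close> is \<open>rogers_dilog 1 - rogers_dilog p\<close>, which
  reflection turns into the claimed sum; starting at \<open>1 / v\<close> with
  \<open>p = v\<^sup>2\<close> makes the initial value vanish.\<close>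

lemma rogers_dilog_sums_plus:
  assumes v: "0 < v" "v < 1" and pv: "p = v\<^sup>2"
  shows "(\<lambda>k. rogers_dilog (p ^ k / v * (1 - p)\<^sup>2 / ((1 + p ^ k / v) * (1 + p * (p * (p ^ k / v))))))
    sums rogers_dilog (1 - p)"
proof -
  have p: "0 < p" "p < 1" using v by (auto simp: pv power_less_one_iff)
  define a where "a x = (1 + p * x) / (1 + x)" for x
  define g where "g x = rogers_dilog (a x) - rogers_dilog (p / a x)" for x
  have lim: "(\<lambda>k. a (p ^ k / v)) \<longlonglongrightarrow> (1 + p * (0 / v)) / (1 + 0 / v)"
    unfolding a_def using p v by (intro tendsto_intros LIMSEQ_power_zero) auto
  \<comment> \<open>The lower bound \<open>p\<close> keeps \<open>p / a x\<close> in the unit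
    interval.\<close>
  have a01: "p \<le> a x \<and> a x \<le> 1" if "x > 0" for x
    using that p by (simp add: a_def field_simps)
  have x: "p ^ k / v > 0" for k using p v by simp
  have "0 \<le> a (p ^ k / v) \<and> a (p ^ k / v) \<le> 1" "0 \<le> p / a (p ^ k / v) \<and> p / a (p ^ k / v) \<le> 1" for k
    using a01[OF x[of k]] p by (auto simp: divide_le_eq)
  with lim have "(\<lambda>k. g (p ^ k / v)) \<longlonglongrightarrow> rogers_dilog 1 - rogers_dilog (p / 1)"
    unfolding g_def using p by (intro tendsto_intros tendsto_rogers_dilog) auto
  then have "(\<lambda>k. g (p ^ Suc k / v) - g (p ^ k / v)) sums
      (rogers_dilog 1 - rogers_dilog (p / 1) - g (p ^ 0 / v))"
    by (rule telescope_sums)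
  moreover have "g (p ^ 0 / v) = 0"
    \<comment> \<open>\<open>a\<close> maps \<open>1 / v\<close> to the fixed point \<open>v\<close> of \<open>y \<mapsto> p / y\<close>.\<close>
  proof -
    have "a (1 / v) = v" using v by (simp add: a_def pv power2_eq_square field_simps)
    moreover have "p / v = v" using v by (simp add: pv power2_eq_square)
    ultimately show ?thesis by (simp add: g_def)
  qed
  moreover have "rogers_dilog 1 - rogers_dilog p = rogers_dilog (1 - p)"
    using rogers_dilog_reflection[of p] p by (simp add: rogers_dilog_1)
  moreover have "g (p ^ Suc k / v) - g (p ^ k / v) =
      rogers_dilog (p ^ k / v * (1 - p)\<^sup>2 / ((1 + p ^ k / v) * (1 + p * (p * (p ^ k / v)))))" for k
    using rogers_dilog_diff_plus[OF p x[of k]] by (simp add: g_def a_def)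
  ultimately show ?thesis by simp
qed

section \<open>Closed forms for the recurrence and evaluation of the two series\<close>

theorem theorem1p3:
  fixes t u :: real and q :: "int \<Rightarrow> real"
  assumes "t > 2"
    and "{x::real. x\<^sup>2 - t * x + 1 = 0} = {u, 1 / u}"
    and "u > 1 / u"
    and "q 0 = 1"
    and "q 1 = t"
    and "\<And>n::int. q n = t * q (n - 1) - q (n - 2)"
  shows "t = u + 1 / u
    \<and> (\<lambda>k::nat. let n = int (Suc k) in
          rogers_dilog (1 / (q n)\<^sup>2))
        sums rogers_dilog (1 / u\<^sup>2)
    \<and> (\<lambda>k::nat. let n = int (Suc k) in
          rogers_dilog ((t - 2) / ((q n - q (n - 1)) * (q (n - 2) - q (n - 3)))))
        sums rogers_dilog (1 - 1 / u\<^sup>2)"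
proof -
  have root: "u\<^sup>2 - t * u + 1 = 0" using assms(2) by blast
  then have "u \<noteq> 0" by auto
  with root have t: "t = u + 1 / u" by (simp add: field_simps power2_eq_square)
  \<comment> \<open>The numbers \<open>u\<close> and \<open>1 / u\<close> have the same sign and a
    positive sum.\<close>
  have "u > 0"
  proof (rule ccontr)
    assume "\<not> u > 0"
    then have "u + 1 / u \<le> 0" by (simp add: add_nonpos_nonpos)
    with t assms(1) show False by simp
  qed
  with assms(3) have "1 < u * u" by (simp add: field_simps)
  with \<open>u > 0\<close> have u1: "u > 1" using mult_le_one[of u u] by linarith
  define v p where "v = 1 / u" and "p = v\<^sup>2"
  have v: "0 < v" "v < 1" using u1 by (auto simp: v_def)
  have p: "0 < p" "p < 1" using v by (auto simp: p_def power_less_one_iff)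
  have u_v: "u = 1 / v" by (simp add: v_def)
  have p_u: "p = 1 / u\<^sup>2" by (simp add: p_def v_def power_divide)
  have t_v: "t = 1 / v + v" using t u_v by simp
  have rec: "q (n + 2) = t * q (n + 1) - q n" for n
    using assms(6)[of "n + 2"] by (simp add: algebra_simps)
  \<comment> \<open>The first term of the second series involves
    \<open>q (- 1) - q (- 2)\<close>.\<close>
  have qm1: "q (- 1) = 0" and qm2: "q (- 2) = - 1"
    using rec[of "-1"] rec[of "-2"] assms(4,5) by auto

  \<comment> \<open>This is \<open>q n = (u ^ (n + 1) - v ^ (n + 1)) / (u - v)\<close> cleared of
    denominators. Two consecutive indices are carried because the recurrence has order two.\<close>
  have q_closed: "q (int n) * (v ^ n * (1 - p)) = 1 - p ^ Suc n
      \<and> q (int n + 1) * (v ^ Suc n * (1 - p)) = 1 - p ^ Suc (Suc n)" for n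
  proof (induction n)
    case 0
    show ?case using v by (simp add: assms(4,5) t_v p_def field_simps power2_eq_square)
  next
    case (Suc n)
    have "q (int n + 2) * (v ^ Suc (Suc n) * (1 - p)) =
        t * v * (q (int n + 1) * (v ^ Suc n * (1 - p))) - p * (q (int n) * (v ^ n * (1 - p)))"
      unfolding rec by (simp add: p_def algebra_simps power2_eq_square)
    also have "\<dots> = (1 + p) * (1 - p ^ Suc (Suc n)) - p * (1 - p ^ Suc n)"
      using Suc v by (simp add: t_v p_def distrib_right power2_eq_square)
    also have "\<dots> = 1 - p ^ Suc (Suc (Suc n))" by (simp add: algebra_simps)
    finally show ?case using Suc by (simp add: add.commute add.left_commute)
  qed
  have first: "1 / (q (int (Suc k)))\<^sup>2 = p ^ Suc k * (1 - p)\<^sup>2 / (1 - p ^ Suc (Suc k))\<^sup>2" for k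
  proof -
    have "(1 - p ^ Suc (Suc k))\<^sup>2 = (q (int (Suc k)))\<^sup>2 * (p ^ Suc k * (1 - p)\<^sup>2)"
      using q_closed[of "Suc k", THEN conjunct1, symmetric]
      by (simp add: power_mult_distrib p_def flip: power_mult) (simp add: power_mult mult.commute)
    then show ?thesis using p by simp
  qed

  define d where "d n = q n - q (n - 1)" for n
  have d_rec: "d (n + 2) = t * d (n + 1) - d n" for n
    using rec[of n] rec[of "n - 1"] by (simp add: d_def algebra_simps)
  \<comment> \<open>The differences obey the same recurrence. The induction starts at index -1, the
    lowest one occurring in the second series.\<close>
  have d_closed: "d (int n - 1) * ((1 + v) * v ^ n) = v + p ^ n
      \<and> d (int n) * ((1 + v) * v ^ Suc n) = v + p ^ Suc n" for n
  proof (induction n)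
    case 0
    show ?case using qm1 qm2 by (simp add: d_def assms(4) p_def algebra_simps power2_eq_square)
  next
    case (Suc n)
    have "d (int n + 1) * ((1 + v) * v ^ Suc (Suc n)) =
        t * v * (d (int n) * ((1 + v) * v ^ Suc n)) - p * (d (int n - 1) * ((1 + v) * v ^ n))"
    proof -
      have d_next: "d (int n + 1) = t * d (int n) - d (int n - 1)"
        using d_rec[of "int n - 1"] by (simp add: algebra_simps)
      show ?thesis
        unfolding d_next by (simp add: p_def algebra_simps power2_eq_square)
    qed
    also have "\<dots> = (1 + p) * (v + p ^ Suc n) - p * (v + p ^ n)"
      using Suc v by (simp add: t_v p_def distrib_right power2_eq_square)
    also have "\<dots> = v + p ^ Suc (Suc n)" by (simp add: algebra_simps)
    finally show ?case using Suc by (simp add: add.commute)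
  qed
  have second: "(t - 2) / (d (int k + 1) * d (int k - 1)) =
      p ^ k / v * (1 - p)\<^sup>2 / ((1 + p ^ k / v) * (1 + p * (p * (p ^ k / v))))" for k
  proof -
    define X where "X = p ^ k"
    have X: "X > 0" using p by (simp add: X_def)
    have vk: "v ^ k * v ^ k = X" by (simp add: X_def p_def power2_eq_square power_mult_distrib)
    have d1: "d (int k - 1) = (v + X) / ((1 + v) * v ^ k)"
      using d_closed[of k] v by (simp add: eq_divide_eq X_def)
    have d2: "d (int k + 1) = (v + p * p * X) / ((1 + v) * (v ^ k * p))"
      using d_closed[of "Suc k"] v p
      by (simp add: eq_divide_eq X_def) (simp add: p_def power2_eq_square mult_ac add_ac)
    have "d (int k + 1) * d (int k - 1) = (v + p * p * X) * (v + X) / ((1 + v)\<^sup>2 * (v ^ k * v ^ k * p))"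
      unfolding d1 d2 by (simp add: power2_eq_square mult_ac)
    then have dd: "d (int k + 1) * d (int k - 1) = (v + p * p * X) * (v + X) / ((1 + v)\<^sup>2 * (X * p))"
      unfolding vk .
    \<comment> \<open>The factor \<open>(1 - v)\<^sup>2\<close> here and
      \<open>(1 + v)\<^sup>2\<close> from the denominator of \<open>dd\<close> combine to
      \<open>(1 - p)\<^sup>2\<close>.\<close>
    have t2: "t - 2 = (1 - v)\<^sup>2 / v"
      using v by (simp add: t_v field_simps power2_eq_square)
    have p1: "(1 - p)\<^sup>2 = (1 - v)\<^sup>2 * (1 + v)\<^sup>2"
      unfolding p_def by algebra
    have "(1 + X / v) * (1 + p * (p * (X / v))) = (v + X) * (v + p * p * X) / p"
      using v by (simp add: p_def field_simps power2_eq_square)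
    then show ?thesis
      unfolding dd t2 p1 X_def[symmetric] by (simp add: mult_ac)
  qed

  have "(\<lambda>k. rogers_dilog (1 / (q (int (Suc k)))\<^sup>2)) sums rogers_dilog (1 / u\<^sup>2)"
    using rogers_dilog_sums_minus[OF p] unfolding first p_u[symmetric] .
  moreover have "(\<lambda>k. rogers_dilog ((t - 2) / (d (int k + 1) * d (int k - 1))))
      sums rogers_dilog (1 - 1 / u\<^sup>2)"
    using rogers_dilog_sums_plus[OF v p_def] unfolding second p_u[symmetric] .
  ultimately show ?thesis
    using t by (simp add: Let_def d_def algebra_simps)
qed

end
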